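(* Let $a,b>0$ be real with $a\neq b$, let $r,k$ be nonnegative integers, let $\bar\alpha_r=(\alpha_0,\dots,\alpha_{r-1})$ be a sequence of complex numbers with $\alpha_i\neq 1$ for all $i$, and let $x,y,z\in\mathbb{R}$. Then for every integer $n\ge 0$, $${}_{p}\mathbb{M}_{n}^{(r)}(x+z,y;k,a,b;\bar\alpha_{r})=\sum_{m=0}^{n}\binom{n}{m}\,\mathbb{M}_{n-m}^{(r)}(z;k,a,b;\bar\alpha_{r})\,p_{m}(x,y).$$
   Context: All generating functions are understood as formal power series in $t$ (with $b^t=e^{t\log b}$, $a^t=e^{t\log a}$). Fix a family of functions $\varphi_n(y)$ and the series $\varphi(y,t)=\sum_{n\ge0}\varphi_n(y)\frac{t^n}{n!}$ with $\varphi_0(y)\neq0$. The 2-variable general polynomials $p_n(x,y)$ are defined by $e^{xt}\varphi(y,t)=\sum_{n\ge 0}p_n(x,y)\frac{t^n}{n!}$, with $p_0(x,y)=1$. The unified family $\mathbb{M}_n^{(r)}(x;k,a,b;\bar\alpha_r)$ is defined by $$\sum_{n=0}^{\infty}\mathbb{M}_{n}^{(r)}(x;k,a,b;\bar\alpha_{r})\frac{t^{n}}{n!}=\frac{(-1)^{r}t^{rk}2^{r(1-k)}}{\prod_{i=0}^{r-1}(\alpha_{i}b^{t}-a^{t})}\,e^{xt}.$$ The 2-variable unified family ${}_{p}\mathbb{M}_{n}^{(r)}(x,y;k,a,b;\bar\alpha_r)$ of generalized Apostol-Euler, Bernoulli and Genocchi polynomials of order $r$ is defined by $$\sum_{n=0}^{\infty}{}_{p}\mathbb{M}_{n}^{(r)}(x,y;k,a,b;\bar\alpha_{r})\frac{t^{n}}{n!}=\frac{(-1)^{r}t^{rk}2^{r(1-k)}}{\prod_{i=0}^{r-1}(\alpha_{i}b^{t}-a^{t})}\,e^{xt}\varphi(y,t).$$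 The left subscript $p$ is only a label referring to the family $p_n(x,y)$. *)

theory Defs
  imports Complex_Main "HOL-Computational_Algebra.Formal_Power_Series"
begin

text \<open>
  All generating functions are formal power series in \<open>t\<close> over the complex numbers.
  The coefficients are complex because the parameters \<open>\<alpha>\<^sub>i\<close> are.
\<close>

definition egf :: "(nat \<Rightarrow> complex) \<Rightarrow> complex fps" where
  "egf c = Abs_fps (\<lambda>n. c n / fact n)"

definition egf_coeff :: "complex fps \<Rightarrow> nat \<Rightarrow> complex" where
  "egf_coeff F n = fact n * fps_nth F n"

lemma egf_egf_coeff: "egf (egf_coeff F) = F"
  by (simp add: egf_def egf_coeff_def fps_eq_iff)

lemma egf_eq_iff: "egf c = F \<longleftrightarrow> (\<forall>n. c n = egf_coeff F n)"
  by (auto simp: egf_def egf_coeff_def fps_eq_iff field_simps)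

text \<open>The series \<open>e^(x t)\<close>, and \<open>c^t = e^(t log c)\<close> for \<open>c > 0\<close>.\<close>

definition exp_t :: "real \<Rightarrow> complex fps" where
  "exp_t x = fps_exp (of_real x)"

definition powr_t :: "real \<Rightarrow> complex fps" where
  "powr_t c = exp_t (ln c)"

definition phi_series :: "(nat \<Rightarrow> real \<Rightarrow> complex) \<Rightarrow> real \<Rightarrow> complex fps" where
  "phi_series \<phi> y = egf (\<lambda>n. \<phi> n y)"

definition gen_poly :: "(nat \<Rightarrow> real \<Rightarrow> complex) \<Rightarrow> nat \<Rightarrow> real \<Rightarrow> real \<Rightarrow> complex" where
  "gen_poly \<phi> n x y = egf_coeff (exp_t x * phi_series \<phi> y) n"

text \<open>
  Only \<open>\<alpha> 0, \<dots>, \<alpha> (r - 1)\<close> matter. The denominator has constant coefficient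
  \<open>\<Prod>i<r. (\<alpha> i - 1)\<close>, so the quotient is the usual one as soon as every such \<open>\<alpha> i\<close> differs
  from 1. The exponent of 2 may be negative, hence the integer power.
\<close>

definition M_kernel :: "nat \<Rightarrow> nat \<Rightarrow> real \<Rightarrow> real \<Rightarrow> (nat \<Rightarrow> complex) \<Rightarrow> complex fps" where
  "M_kernel r k a b \<alpha> =
     ((-1) ^ r * fps_X ^ (r * k) * fps_const (2 powi (int r * (1 - int k)))) /
     (\<Prod>i<r. fps_const (\<alpha> i) * powr_t b - powr_t a)"

lemma M_kernel_denominator_nth_0:
  fixes r :: nat
  shows "fps_nth (\<Prod>i<r. fps_const (\<alpha> i) * powr_t b - powr_t a) 0 = (\<Prod>i<r. \<alpha> i - 1)"
  by (induction r) (simp_all add: powr_t_def exp_t_def)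

lemma M_kernel_mult_denominator:
  assumes "\<And>i. i < r \<Longrightarrow> \<alpha> i \<noteq> 1"
  shows "M_kernel r k a b \<alpha> * (\<Prod>i<r. fps_const (\<alpha> i) * powr_t b - powr_t a) =
    (-1) ^ r * fps_X ^ (r * k) * fps_const (2 powi (int r * (1 - int k)))"
proof -
  have "fps_nth (\<Prod>i<r. fps_const (\<alpha> i) * powr_t b - powr_t a) 0 \<noteq> 0"
    using assms by (simp add: M_kernel_denominator_nth_0)
  then show ?thesis
    by (simp add: M_kernel_def fps_divide_unit mult.assoc inverse_mult_eq_1)
qed

definition unified_M ::
  "nat \<Rightarrow> nat \<Rightarrow> real \<Rightarrow> nat \<Rightarrow> real \<Rightarrow> real \<Rightarrow> (nat \<Rightarrow> complex) \<Rightarrow> complex" where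
  "unified_M r n x k a b \<alpha> = egf_coeff (M_kernel r k a b \<alpha> * exp_t x) n"

definition unified_pM ::
  "(nat \<Rightarrow> real \<Rightarrow> complex) \<Rightarrow> nat \<Rightarrow> nat \<Rightarrow> real \<Rightarrow> real \<Rightarrow> nat \<Rightarrow> real \<Rightarrow> real \<Rightarrow>
    (nat \<Rightarrow> complex) \<Rightarrow> complex" where
  "unified_pM \<phi> r n x y k a b \<alpha> =
     egf_coeff (M_kernel r k a b \<alpha> * exp_t x * phi_series \<phi> y) n"

end

theory Submission
  imports Defs
begin

text \<open>
  The kernel does not depend on \<open>x\<close>, and \<open>e^((x + z) t) = e^(z t) e^(x t)\<close>. The generating series
  of the two-variable family at \<open>x + z\<close> is therefore the product of the generating series of the
  one-variable family at \<open>z\<close> and that of the polynomials \<open>p\<^sub>m(x, y)\<close>. Multiplying two exponential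
  generating series convolves their coefficients binomially (\<open>egf_coeff_mult\<close>), which is the claim.
\<close>

lemma exp_t_add: "exp_t (x + z) = exp_t x * exp_t z"
  by (simp add: exp_t_def fps_exp_add_mult)

text \<open>
  The factorials turn the Cauchy product into a binomial convolution, because
  \<open>n! = (n choose m) m! (n - m)!\<close>.
\<close>

lemma egf_coeff_mult:
  "egf_coeff (F * G) n =
    (\<Sum>m=0..n. of_nat (n choose m) * egf_coeff F (n - m) * egf_coeff G m)"
proof -
  have "egf_coeff (F * G) n = (\<Sum>m=0..n. fact n * (fps_nth G m * fps_nth F (n - m)))"
    by (simp add: egf_coeff_def mult.commute[of F G] fps_mult_nth sum_distrib_left)
  also have "\<dots> = (\<Sum>m=0..n. of_nat (n choose m) * egf_coeff F (n - m) * egf_coeff G m)"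
    by (rule sum.cong) (simp_all add: egf_coeff_def binomial_fact field_simps)
  finally show ?thesis .
qed

theorem theorem3p5:
  fixes \<phi> :: "nat \<Rightarrow> real \<Rightarrow> complex"
    and a b x y z :: real
    and r k n :: nat
    and \<alpha> :: "nat \<Rightarrow> complex"
  assumes "\<And>y. \<phi> 0 y \<noteq> 0"
    and "\<And>x y. gen_poly \<phi> 0 x y = 1"
    and "a > 0" and "b > 0" and "a \<noteq> b"
    and "\<And>i. i < r \<Longrightarrow> \<alpha> i \<noteq> 1"
  shows "unified_pM \<phi> r n (x + z) y k a b \<alpha> =
    (\<Sum>m=0..n. of_nat (n choose m) * unified_M r (n - m) z k a b \<alpha> * gen_poly \<phi> m x y)"
proof -
  have "M_kernel r k a b \<alpha> * exp_t (x + z) * phi_series \<phi> y =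
      (M_kernel r k a b \<alpha> * exp_t z) * (exp_t x * phi_series \<phi> y)"
    by (simp add: exp_t_add mult_ac)
  then show ?thesis
    unfolding unified_pM_def unified_M_def gen_poly_def
    by (simp only: egf_coeff_mult[of "M_kernel r k a b \<alpha> * exp_t z" "exp_t x * phi_series \<phi> y"])
qed

end
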